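(* The range of $\mathcal{D}(\mathbb{R})$ under the Bessel-Struve transform of index $\frac12$ is $$\mathcal{F}^{\frac12}_{B,S}(\mathcal{D}(\mathbb{R}))=\Lambda_{\frac12},$$ where, for $f\in\mathcal{D}(\mathbb{R})$, $\mathcal{F}^{\frac12}_{B,S}(f)$ is identified with its extension to an entire function on $\mathbb{C}$.
   Context: $\mathcal{D}(\mathbb{R})$ is the space of infinitely differentiable (complex-valued) functions on $\mathbb{R}$ with compact support. For $\alpha>-\frac12$, the Bessel-Struve kernel is $S_\lambda^\alpha(x)=\frac{2\Gamma(\alpha+1)}{\sqrt\pi\,\Gamma(\alpha+\frac12)}\int_0^1(1-t^2)^{\alpha-\frac12}e^{\lambda xt}\,dt$ and the Bessel-Struve transform is $\mathcal{F}_{B,S}^\alpha(f)(\lambda)=\int_{\mathbb{R}}f(x)\,S_{-i\lambda}^\alpha(x)\,|x|^{2\alpha+1}dx$; for $f\in\mathcal{D}(\mathbb{R})$ the same formula for $\lambda\in\mathbb{C}$ gives its entire extension. For $a>0$, $\mathcal{H}_a$ is the space of entire functions $f$ such that for every $n\in\mathbb{N}$ there exists $c_n>0$ with $(1+|z|^2)^n|f(z)|e^{-a|\mathrm{Im}(z)|}<c_n$ for all $z\in\mathbb{C}$. $\Lambda_{a,\frac12}$ is the space of entire functions $g$ for which there exists $h\in\mathcal{H}_a$ such that $g(z)=\frac{h'(z)-h'(0)}{z}$ for all $z\in\mathbb{C}\setminus\{0\}$. Finally $\Lambda_{\frac12}=\bigcup_{a>0}\Lambda_{a,\frac12}$. 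*)

theory Defs
  imports "HOL-Complex_Analysis.Complex_Analysis"
begin

text \<open>The iterates of \<^term>\<open>\<lambda>g t. vector_derivative g (at t)\<close> are the successive derivatives;
  requiring every one of them to be differentiable everywhere says that the function is
  infinitely differentiable.\<close>

definition smooth :: "(real \<Rightarrow> complex) \<Rightarrow> bool" where
  "smooth f \<longleftrightarrow>
     (\<forall>n x. ((\<lambda>g t. vector_derivative g (at t)) ^^ n) f differentiable (at x))"

definition test_functions :: "(real \<Rightarrow> complex) set" where
  "test_functions = {f. smooth f \<and> compact (closure {x. f x \<noteq> 0})}"

text \<open>The weight \<^term>\<open>(1 - t\<^sup>2) powr (\<alpha> - 1/2)\<close> is \<^term>\<open>0 :: real\<close> at the end point
  \<^term>\<open>t = (1 :: real)\<close> for every exponent, since \<^term>\<open>0 powr x = (0 :: real)\<close>; this affects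
  only a null set.\<close>

definition bessel_struve_kernel :: "real \<Rightarrow> complex \<Rightarrow> real \<Rightarrow> complex" where
  "bessel_struve_kernel \<alpha> z x =
     complex_of_real (2 * Gamma (\<alpha> + 1) / (sqrt pi * Gamma (\<alpha> + 1/2))) *
     (LINT t:{0..1}|lborel.
        complex_of_real ((1 - t\<^sup>2) powr (\<alpha> - 1/2)) * exp (z * of_real x * of_real t))"

text \<open>The spectral variable is complex: for a test function this is the entire extension
  of the transform, whose original domain is the real line.\<close>

definition bessel_struve_transform :: "real \<Rightarrow> (real \<Rightarrow> complex) \<Rightarrow> complex \<Rightarrow> complex" where
  "bessel_struve_transform \<alpha> f z =
     (LINT x|lborel.
        f x * bessel_struve_kernel \<alpha> (- \<i> * z) x * complex_of_real (\<bar>x\<bar> powr (2 * \<alpha> + 1)))"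

definition H_space :: "real \<Rightarrow> (complex \<Rightarrow> complex) set" where
  "H_space a = {f. f holomorphic_on UNIV \<and>
     (\<forall>n::nat. \<exists>c>0. \<forall>z. (1 + (cmod z)\<^sup>2) ^ n * cmod (f z) * exp (- a * \<bar>Im z\<bar>) < c)}"

definition Lambda_half_space :: "real \<Rightarrow> (complex \<Rightarrow> complex) set" where
  "Lambda_half_space a = {g. g holomorphic_on UNIV \<and>
     (\<exists>h\<in>H_space a. \<forall>z. z \<noteq> 0 \<longrightarrow> g z = (deriv h z - deriv h 0) / z)}"

definition Lambda_half :: "(complex \<Rightarrow> complex) set" where
  "Lambda_half = (\<Union>a\<in>{0<..}. Lambda_half_space a)"

end

theory Submission
  imports Defs "HOL-Probability.Sinc_Integral"
begin

text \<open>For index \<open>1/2\<close> the weight of the kernel is constant and the kernel is \<open>(e\<^sup>w - 1)/w\<close>, so that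
  the transform of \<open>f\<close> equals \<open>(h'(z) - h'(0))/z\<close> with \<open>h\<close> the negative of the Fourier--Laplace
  transform of \<open>f\<close>. What remains is the Paley--Wiener theorem: the Fourier--Laplace transform maps
  test functions onto the union of the spaces \<open>H\<^sub>a\<close>. Surjectivity uses the inverse Fourier
  integral \<open>f\<close> of \<open>h\<close>. Moving its line of integration to height \<open>y \<longrightarrow> \<infinity>\<close> shows that \<open>f\<close> vanishes beyond
  \<open>a\<close>. For the inversion formula, the parts of \<open>f\<close> on the positive and negative half lines are written
  over the lines at height \<open>y\<close> and \<open>-y\<close>; by Fubini their transforms are Cauchy integrals of \<open>h\<close> along
  these two lines, and they add up to \<open>h(z)\<close> by Cauchy's formula in the strip.\<close>

section \<open>The Fourier--Laplace transform of a test function\<close>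

definition fourier_laplace :: "(real \<Rightarrow> complex) \<Rightarrow> complex \<Rightarrow> complex" where
  "fourier_laplace f z = (LINT x|lborel. f x * exp (- \<i> * z * of_real x))"

text \<open>Bridge between the Lebesgue integral of the definitions and the gauge integral on an
  interval, for which the Leibniz rule and the fundamental theorem of calculus are stated. No sign
  of \<open>a\<close> is assumed: for negative \<open>a\<close> the interval is empty and
  \<open>f\<close> vanishes identically.\<close>

lemma compact_support_integral:
  fixes f :: "real \<Rightarrow> 'a::euclidean_space"
  assumes "continuous_on UNIV f" "\<forall>x. \<bar>x\<bar> > a \<longrightarrow> f x = 0"
  shows "integrable lborel f" "(f has_integral (LINT x|lborel. f x)) {-a..a}"
proof -
  have "set_integrable lborel {-a..a} f"
    using assms(1) by (intro borel_integrable_atLeastAtMost') (rule continuous_on_subset, auto)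
  moreover have out: "f x = 0" if "x \<notin> {-a..a}" for x
  proof -
    have "\<bar>x\<bar> > a" using that by (auto simp: abs_if)
    then show ?thesis using assms(2) by blast
  qed
  moreover have "(\<lambda>x. indicator {-a..a} x *\<^sub>R f x) = f"
    using out by (fastforce simp: indicator_def)
  ultimately show i: "integrable lborel f"
    by (simp add: set_integrable_def)
  have "(f has_integral (LINT x|lborel. f x)) UNIV"
    by (rule has_integral_integral_lborel[OF i])
  moreover have "(\<lambda>x. if x \<in> {-a..a} then f x else 0) = f"
    using out by (simp add: fun_eq_iff)
  ultimately show "(f has_integral (LINT x|lborel. f x)) {-a..a}"
    by (subst has_integral_restrict_UNIV[symmetric]) (simp only:)
qed

lemma compact_support_mult_exp:
  fixes f :: "real \<Rightarrow> complex"
  assumes "continuous_on UNIV f" "\<forall>x. \<bar>x\<bar> > a \<longrightarrow> f x = 0"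
  shows "integrable lborel (\<lambda>x. f x * exp (- \<i> * z * of_real x))"
    "((\<lambda>x. f x * exp (- \<i> * z * of_real x)) has_integral fourier_laplace f z) {-a..a}"
  unfolding fourier_laplace_def
  by (rule compact_support_integral[of _ a]; use assms in \<open>auto intro!: continuous_intros\<close>)+

text \<open>Differentiation under the integral sign over the compact interval from \<open>-a\<close>
  to \<open>a\<close>: the derivative of the kernel in \<open>z\<close> is jointly continuous and
  brings down the factor \<open>-i x\<close>.\<close>

lemma has_field_derivative_fourier_laplace:
  assumes "continuous_on UNIV f" "\<forall>x. \<bar>x\<bar> > a \<longrightarrow> f x = 0"
  shows "(fourier_laplace f has_field_derivative fourier_laplace (\<lambda>x. - \<i> * of_real x * f x) z) (at z)"
proof -
  have c[continuous_intros]: "continuous_on S (\<lambda>x. f (g x))" if "continuous_on S g" for S and g :: "'b::topological_space \<Rightarrow> real"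
    using continuous_on_compose2[OF assms(1) that] by auto
  have "((\<lambda>z. integral (cbox (-a) a) (\<lambda>x. f x * exp (- \<i> * z * of_real x))) has_field_derivative
      integral (cbox (-a) a) (\<lambda>x. (- \<i> * of_real x * f x) * exp (- \<i> * z * of_real x))) (at z within UNIV)"
  proof (rule leibniz_rule_field_derivative)
    show "(\<lambda>x. f x * exp (- \<i> * w * of_real x)) integrable_on cbox (-a) a" for w
      by (intro integrable_continuous continuous_intros)
  qed (auto intro!: derivative_eq_intros continuous_intros simp: split_beta)
  moreover have "fourier_laplace f = (\<lambda>z. integral (cbox (-a) a) (\<lambda>x. f x * exp (- \<i> * z * of_real x)))"
    using integral_unique[OF compact_support_mult_exp(2)[OF assms]] by (simp add: fun_eq_iff)
  moreover have "((\<lambda>x. (- \<i> * of_real x * f x) * exp (- \<i> * z * of_real x))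
      has_integral fourier_laplace (\<lambda>x. - \<i> * of_real x * f x) z) {-a..a}"
    by (rule compact_support_mult_exp(2)) (use assms in \<open>auto intro!: continuous_intros\<close>)
  then have "integral (cbox (-a) a) (\<lambda>x. (- \<i> * of_real x * f x) * exp (- \<i> * z * of_real x)) =
      fourier_laplace (\<lambda>x. - \<i> * of_real x * f x) z"
    unfolding interval_cbox by (rule integral_unique)
  ultimately show ?thesis
    by (simp only:)
qed

lemma norm_exp_fourier: "cmod (exp (- \<i> * z * of_real x)) = exp (Im z * x)"
  by simp

text \<open>The kernel has modulus \<open>exp (Im z * x)\<close>, and where \<open>f\<close> does
  not vanish, |x| <= a bounds it by \<open>exp (a * |Im z|)\<close>. This is the source of the
  exponential type \<open>a\<close> in \<open>H_space a\<close>.\<close>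

lemma norm_fourier_laplace_le:
  assumes "continuous_on UNIV f" "\<forall>x. \<bar>x\<bar> > a \<longrightarrow> f x = 0"
  shows "cmod (fourier_laplace f z) \<le> exp (a * \<bar>Im z\<bar>) * (LINT x|lborel. cmod (f x))"
proof -
  have i: "integrable lborel f"
    by (rule compact_support_integral[OF assms])
  have "cmod (fourier_laplace f z) \<le> (LINT x|lborel. cmod (f x * exp (- \<i> * z * of_real x)))"
    unfolding fourier_laplace_def by (rule integral_norm_bound)
  also have "\<dots> \<le> (LINT x|lborel. exp (a * \<bar>Im z\<bar>) * cmod (f x))"
  proof (rule integral_mono)
    show "integrable lborel (\<lambda>x. cmod (f x * exp (- \<i> * z * of_real x)))"
      using compact_support_mult_exp(1)[OF assms, of z] by (rule integrable_norm)
    show "integrable lborel (\<lambda>x. exp (a * \<bar>Im z\<bar>) * cmod (f x))"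
      using i by auto
    show "cmod (f x * exp (- \<i> * z * of_real x)) \<le> exp (a * \<bar>Im z\<bar>) * cmod (f x)" for x
    proof (cases "\<bar>x\<bar> > a")
      case False
      have "Im z * x \<le> \<bar>Im z\<bar> * \<bar>x\<bar>"
        by (metis abs_ge_self abs_mult)
      also have "\<dots> \<le> \<bar>Im z\<bar> * a"
        using False by (intro mult_left_mono) auto
      finally show ?thesis
        unfolding norm_mult norm_exp_fourier by (simp add: mult.commute mult_left_mono)
    qed (simp add: assms)
  qed
  finally show ?thesis by simp
qed

text \<open>Integration by parts; the boundary terms vanish.\<close>

lemma fourier_laplace_vector_derivative:
  assumes "\<And>x. (f has_vector_derivative f' x) (at x)" "continuous_on UNIV f'"
    and "\<forall>x. \<bar>x\<bar> > a \<longrightarrow> f x = 0" "\<forall>x. \<bar>x\<bar> > a \<longrightarrow> f' x = 0"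
  shows "fourier_laplace f' z = \<i> * z * fourier_laplace f z"
proof -
  \<comment> \<open>The support hypothesis is strict and does not mention the points
    \<open>a\<close> and \<open>-a\<close>. A bound larger than |a| makes \<open>f\<close> vanish at
    both end points and keeps the interval nonempty whatever the sign of \<open>a\<close>.\<close>
  define b where "b = \<bar>a\<bar> + 1"
  have cf: "continuous_on UNIV f"
    using assms(1) by (meson continuous_at_imp_continuous_on has_vector_derivative_continuous)
  have van: "\<forall>x. \<bar>x\<bar> > b \<longrightarrow> f x = 0" "\<forall>x. \<bar>x\<bar> > b \<longrightarrow> f' x = 0" "f b = 0" "f (-b) = 0"
    using assms(3,4) by (auto simp: b_def)
  have "((\<lambda>x. f' x * exp (- \<i> * z * of_real x) - \<i> * z * (f x * exp (- \<i> * z * of_real x))) has_integral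
      f b * exp (- \<i> * z * of_real b) - f (-b) * exp (- \<i> * z * of_real (-b))) {-b..b}"
  proof (rule fundamental_theorem_of_calculus)
    show "-b \<le> b" by (simp add: b_def)
    fix x
    have e: "((\<lambda>x::real. exp (- \<i> * z * of_real x)) has_vector_derivative - \<i> * z * exp (- \<i> * z * of_real x)) (at x)"
      by (rule has_vector_derivative_real_field) (auto intro!: derivative_eq_intros)
    show "((\<lambda>x. f x * exp (- \<i> * z * of_real x)) has_vector_derivative
       f' x * exp (- \<i> * z * of_real x) - \<i> * z * (f x * exp (- \<i> * z * of_real x))) (at x within {-b..b})"
      using has_vector_derivative_at_within[OF has_vector_derivative_mult[OF assms(1)[of x] e], of "{-b..b}"]
      by (simp add: algebra_simps)
  qed
  moreover have "((\<lambda>x. f' x * exp (- \<i> * z * of_real x) - \<i> * z * (f x * exp (- \<i> * z * of_real x))) has_integral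
      fourier_laplace f' z - \<i> * z * fourier_laplace f z) {-b..b}"
    by (intro has_integral_diff has_integral_mult_right compact_support_mult_exp(2) cf assms(2) van) 
  ultimately show ?thesis
    by (auto simp: van dest: has_integral_unique)
qed

abbreviation nderiv :: "nat \<Rightarrow> (real \<Rightarrow> complex) \<Rightarrow> real \<Rightarrow> complex" where
  "nderiv n \<equiv> (\<lambda>g t. vector_derivative g (at t)) ^^ n"

lemma nderiv_eq_0:
  assumes "\<forall>x. \<bar>x\<bar> > a \<longrightarrow> f x = 0"
  shows "\<forall>x. \<bar>x\<bar> > a \<longrightarrow> nderiv n f x = 0"
proof (induction n)
  case (Suc n)
  show ?case
  proof (intro allI impI)
    fix x :: real
    assume x: "\<bar>x\<bar> > a"
    have "open {x::real. \<bar>x\<bar> > a}"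
      by (intro open_Collect_less continuous_intros)
    then have "(nderiv n f has_vector_derivative 0) (at x)"
      by (rule has_vector_derivative_transform_within_open[OF has_vector_derivative_const]) (use x Suc in auto)
    then show "nderiv (Suc n) f x = 0"
      by (simp add: vector_derivative_at)
  qed
qed (use assms in auto)

lemma test_functions_support:
  assumes "f \<in> test_functions"
  obtains a where "a > 0" "\<forall>x. \<bar>x\<bar> > a \<longrightarrow> f x = 0"
proof -
  have "bounded {x. f x \<noteq> 0}"
    using assms by (auto simp: test_functions_def intro: bounded_subset[OF compact_imp_bounded closure_subset])
  then obtain a where "a > 0" "\<forall>x\<in>{x. f x \<noteq> 0}. norm x \<le> a"
    by (auto simp: bounded_pos)
  then show ?thesis
    using that[of a] by force
qed

lemma smooth_nderiv:
  assumes "smooth f"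
  shows "(nderiv n f has_vector_derivative nderiv (Suc n) f x) (at x)" "continuous_on UNIV (nderiv n f)"
  using assms
  by (auto simp: smooth_def vector_derivative_works[symmetric] intro!: continuous_at_imp_continuous_on
      differentiable_imp_continuous_within)

text \<open>Reduces the weight in \<open>H_space\<close> to the two powers 1 and |z|^(2n), each of
  which is controlled by the transform of a derivative.\<close>

lemma one_plus_power_le:
  fixes r :: real
  assumes "r \<ge> 0"
  shows "(1 + r) ^ n \<le> 2 ^ n * (1 + r ^ n)"
proof -
  have "(1 + r) ^ n \<le> (2 * max 1 r) ^ n"
    using assms by (intro power_mono) auto
  also have "\<dots> = 2 ^ n * max 1 r ^ n"
    by (simp add: power_mult_distrib)
  also have "max 1 r ^ n \<le> 1 + r ^ n"
    using assms by (auto simp: max_def)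
  finally show ?thesis by simp
qed

text \<open>The direct half of Paley-Wiener: the transform of the n-th derivative is
  \<open>(i z)^n\<close> times that of \<open>f\<close> and is bounded by
  \<open>exp (a * |Im z|)\<close> times the L1 norm \<open>B n\<close>.\<close>

lemma fourier_laplace_in_H_space:
  assumes "smooth f" "\<forall>x. \<bar>x\<bar> > a \<longrightarrow> f x = 0"
  shows "fourier_laplace f \<in> H_space a"
proof -
  have c: "continuous_on UNIV f"
    using smooth_nderiv(2)[OF assms(1), of 0] by simp
  define B where "B n = (LINT x|lborel. cmod (nderiv n f x))" for n
  have B0: "B n \<ge> 0" for n
    by (simp add: B_def)
  have FL: "fourier_laplace (nderiv n f) z = (\<i> * z) ^ n * fourier_laplace f z" for n z
  proof (induction n)
    case (Suc n)
    have "fourier_laplace (nderiv (Suc n) f) z = \<i> * z * fourier_laplace (nderiv n f) z"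
      by (rule fourier_laplace_vector_derivative[where a=a])
         (use smooth_nderiv[OF assms(1)] nderiv_eq_0[OF assms(2)] in \<open>blast+\<close>)
    with Suc show ?case by simp
  qed simp
  have bd: "cmod z ^ n * cmod (fourier_laplace f z) \<le> exp (a * \<bar>Im z\<bar>) * B n" for n z
  proof -
    have "cmod (fourier_laplace (nderiv n f) z) \<le> exp (a * \<bar>Im z\<bar>) * B n"
      unfolding B_def by (rule norm_fourier_laplace_le[OF smooth_nderiv(2)[OF assms(1)] nderiv_eq_0[OF assms(2)]])
    then show ?thesis
      by (simp add: FL norm_mult norm_power)
  qed
  \<comment> \<open>The derivatives of order 0 and 2n account for \<open>B 0\<close> and
    \<open>B (2 * n)\<close>. The summand 1 provides the strict inequality and the positive constant
    that \<open>H_space\<close> demands.\<close>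
  have "(1 + (cmod z)\<^sup>2) ^ n * cmod (fourier_laplace f z) * exp (- a * \<bar>Im z\<bar>) < 2 ^ n * (B 0 + B (2 * n)) + 1" for n z
  proof -
    have "(1 + (cmod z)\<^sup>2) ^ n * cmod (fourier_laplace f z) \<le> (2 ^ n * (1 + cmod z ^ (2 * n))) * cmod (fourier_laplace f z)"
      using one_plus_power_le[of "(cmod z)\<^sup>2" n] by (intro mult_right_mono) (auto simp: power_mult)
    also have "\<dots> = 2 ^ n * (cmod z ^ 0 * cmod (fourier_laplace f z) + cmod z ^ (2 * n) * cmod (fourier_laplace f z))"
      by (simp add: algebra_simps)
    also have "\<dots> \<le> 2 ^ n * (exp (a * \<bar>Im z\<bar>) * B 0 + exp (a * \<bar>Im z\<bar>) * B (2 * n))"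
      by (intro mult_left_mono add_mono bd) auto
    finally have "(1 + (cmod z)\<^sup>2) ^ n * cmod (fourier_laplace f z) * exp (- a * \<bar>Im z\<bar>)
        \<le> 2 ^ n * (exp (a * \<bar>Im z\<bar>) * B 0 + exp (a * \<bar>Im z\<bar>) * B (2 * n)) * exp (- a * \<bar>Im z\<bar>)"
      by (rule mult_right_mono) simp
    also have "\<dots> = 2 ^ n * (B 0 + B (2 * n))"
      by (simp add: exp_minus field_simps)
    finally show ?thesis by simp
  qed
  moreover have "2 ^ n * (B 0 + B (2 * n)) + 1 > 0" for n
    using B0 by (simp add: add_nonneg_pos)
  moreover have "fourier_laplace f holomorphic_on UNIV"
    using has_field_derivative_fourier_laplace[OF c assms(2)] by (auto simp: holomorphic_on_open)
  ultimately show ?thesis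
    unfolding H_space_def by blast
qed

section \<open>The transform of index one half\<close>

lemma integral_exp_unit_interval:
  fixes w :: complex
  shows "(LINT t:{0..1}|lborel. exp (w * of_real t)) = (if w = 0 then 1 else (exp w - 1) / w)"
proof -
  have "set_integrable lborel {0..1} (\<lambda>t. exp (w * of_real t))"
    by (intro borel_integrable_atLeastAtMost' continuous_intros)
  then have "(LINT t:{0..1}|lborel. exp (w * of_real t)) = integral {0..1} (\<lambda>t. exp (w * of_real t))"
    by (rule set_borel_integral_eq_integral)
  also have "\<dots> = (if w = 0 then 1 else (exp w - 1) / w)"
  proof (cases "w = 0")
    case False
    have "((\<lambda>t. exp (w * of_real t)) has_integral exp (w * of_real 1) / w - exp (w * of_real 0) / w) {0..1}"
      by (rule fundamental_theorem_of_calculus)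
         (use False in \<open>auto intro!: has_vector_derivative_at_within has_vector_derivative_real_field derivative_eq_intros\<close>)
    then show ?thesis
      using False by (simp add: integral_unique diff_divide_distrib)
  qed simp
  finally show ?thesis .
qed

text \<open>At index 1/2 the weight has exponent 0, and the normalising constant is 1 because
  Gamma(3/2) is half of sqrt(pi).\<close>

lemma bessel_struve_kernel_half:
  "bessel_struve_kernel (1/2) z x =
     (if z * of_real x = 0 then 1 else (exp (z * of_real x) - 1) / (z * of_real x))"
proof -
  have "2 * Gamma (1/2 + 1) / (sqrt pi * Gamma (1/2 + 1/2)) = (1::real)"
  proof -
    have "(1/2::real) \<notin> \<int>\<^sub>\<le>\<^sub>0"
      using nonpos_Ints_nonpos by fastforce
    then have "Gamma (1/2 + 1) = sqrt pi / 2"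
      by (subst Gamma_plus1) (auto simp: Gamma_one_half_real)
    then show ?thesis by simp
  qed
  moreover have "(LINT t:{0..1}|lborel. complex_of_real ((1 - t\<^sup>2) powr (1/2 - 1/2)) * exp (z * of_real x * of_real t))
      = (LINT t:{0..1}|lborel. exp (z * of_real x * of_real t))"
    unfolding set_lebesgue_integral_def
  proof (rule integral_cong_AE)
    \<comment> \<open>At t = 1 the weight is \<open>0 powr 0 = 0\<close> instead of 1, so the
      integrands agree only almost everywhere.\<close>
    have "AE t in lborel. t \<noteq> (1::real)"
      by (rule AE_lborel_singleton)
    then show "AE t in lborel. indicator {0..1} t *\<^sub>R (complex_of_real ((1 - t\<^sup>2) powr (1/2 - 1/2)) * exp (z * of_real x * of_real t))
       = indicator {0..1} t *\<^sub>R exp (z * of_real x * of_real t)"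
      by eventually_elim (auto simp: indicator_def power2_eq_1_iff)
  qed auto
  ultimately show ?thesis
    unfolding bessel_struve_kernel_def by (simp only: integral_exp_unit_interval of_real_1 mult_1_left)
qed

text \<open>The weight is x^2, and x^2 times the kernel is
  \<open>i x (exp (-i z x) - 1) / z\<close>. This produces the transform of \<open>i x f(x)\<close>,
  which is \<open>deriv h\<close>: the minus sign in \<open>h\<close> compensates the factor
  \<open>-i x\<close> of differentiation. At z = 0 the kernel is 1 and the integral of
  \<open>x^2 f(x)\<close> is the second derivative of \<open>h\<close> there.\<close>

lemma bessel_struve_transform_half:
  assumes "continuous_on UNIV f" "\<forall>x. \<bar>x\<bar> > a \<longrightarrow> f x = 0"
  defines "h \<equiv> (\<lambda>z. - fourier_laplace f z)"
  shows "bessel_struve_transform (1/2) f z = (if z = 0 then deriv (deriv h) 0 else (deriv h z - deriv h 0) / z)"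
proof -
  let ?g = "\<lambda>x. \<i> * of_real x * f x"
  have cg: "continuous_on UNIV ?g" and vg: "\<forall>x. \<bar>x\<bar> > a \<longrightarrow> ?g x = 0"
    using assms by (auto intro!: continuous_intros)
  have h': "deriv h = fourier_laplace ?g"
  proof
    fix w
    have "(h has_field_derivative - fourier_laplace (\<lambda>x. - \<i> * of_real x * f x) w) (at w)"
      unfolding h_def by (intro DERIV_minus has_field_derivative_fourier_laplace[OF assms(1,2)])
    then show "deriv h w = fourier_laplace ?g w"
      by (subst DERIV_imp_deriv) (auto simp: fourier_laplace_def)
  qed
  have h'': "deriv (deriv h) 0 = fourier_laplace (\<lambda>x. - \<i> * of_real x * ?g x) 0"
    unfolding h' by (rule DERIV_imp_deriv has_field_derivative_fourier_laplace[OF cg vg])+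
  show ?thesis
  proof (cases "z = 0")
    case True
    moreover have "f x * complex_of_real (\<bar>x\<bar> powr 2) = - \<i> * of_real x * ?g x" for x
      by (simp add: power2_eq_square algebra_simps)
    ultimately show ?thesis
      by (simp add: h'' fourier_laplace_def bessel_struve_transform_def bessel_struve_kernel_half)
  next
    case False
    \<comment> \<open>The 1 in the numerator of the kernel is written as the exponential at spectral
      value 0, so that it integrates to \<open>fourier_laplace ?g 0\<close>. At x = 0 both sides
      vanish.\<close>
    have "f x * bessel_struve_kernel (1/2) (- \<i> * z) x * complex_of_real (\<bar>x\<bar> powr (2 * (1/2) + 1))
       = (?g x * exp (- \<i> * z * of_real x) - ?g x * exp (- \<i> * 0 * of_real x)) / z" for x
    proof -
      have "complex_of_real (\<bar>x\<bar> powr (2 * (1/2) + 1)) = of_real x * of_real x"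
        by (simp add: power2_eq_square flip: of_real_mult)
      moreover have "- inverse \<i> = \<i>" by simp
      ultimately show ?thesis
        using False by (simp add: bessel_struve_kernel_half field_simps)
    qed
    then have "bessel_struve_transform (1/2) f z =
        (LINT x|lborel. (?g x * exp (- \<i> * z * of_real x) - ?g x * exp (- \<i> * 0 * of_real x)) / z)"
      unfolding bessel_struve_transform_def by presburger
    also have "\<dots> = (fourier_laplace ?g z - fourier_laplace ?g 0) / z"
      unfolding fourier_laplace_def integral_divide_zero
      by (subst Bochner_Integration.integral_diff) (intro compact_support_mult_exp(1)[OF cg vg] refl)+
    finally show ?thesis
      using False by (simp add: h')
  qed
qed

text \<open>The difference quotient of \<open>deriv ?h\<close> has a removable singularity at 0, and
  the transform takes there the value that \<open>pole_lemma\<close> prescribes.\<close>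

lemma holomorphic_bessel_struve_transform_half:
  assumes "continuous_on UNIV f" "\<forall>x. \<bar>x\<bar> > a \<longrightarrow> f x = 0"
  shows "bessel_struve_transform (1/2) f holomorphic_on UNIV"
proof -
  let ?h = "\<lambda>z. - fourier_laplace f z"
  have "fourier_laplace f holomorphic_on UNIV"
    using has_field_derivative_fourier_laplace[OF assms] by (auto simp: holomorphic_on_open)
  then have "deriv ?h holomorphic_on UNIV"
    by (intro holomorphic_deriv holomorphic_intros) auto
  then have "(\<lambda>z. if z = 0 then deriv (deriv ?h) 0 else (deriv ?h z - deriv ?h 0) / (z - 0)) holomorphic_on UNIV"
    by (rule pole_lemma) auto
  moreover have "bessel_struve_transform (1/2) f =
      (\<lambda>z. if z = 0 then deriv (deriv ?h) 0 else (deriv ?h z - deriv ?h 0) / (z - 0))"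
    using bessel_struve_transform_half[OF assms] by (auto simp: fun_eq_iff)
  ultimately show ?thesis by simp
qed

section \<open>Cauchy's formula in a strip\<close>

lemma integrable_inverse_one_plus_square: "integrable lborel (\<lambda>x::real. 1 / (1 + x\<^sup>2))"
  using integrable_inverse_1_plus_square by (simp add: set_integrable_def inverse_eq_divide)

lemma integrable_quadratic_decay:
  fixes g :: "real \<Rightarrow> complex"
  assumes "continuous_on UNIV g" "\<And>x. cmod (g x) \<le> M / (1 + x\<^sup>2)"
  shows "integrable lborel g"
proof (rule Bochner_Integration.integrable_bound)
  show "integrable lborel (\<lambda>x. M * (1 / (1 + x\<^sup>2)))"
    by (intro integrable_mult_right integrable_inverse_one_plus_square)
  have "cmod (g x) \<le> norm (M * (1 / (1 + x\<^sup>2)))" for x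
    using order_trans[OF assms(2) abs_ge_self] by simp
  then show "AE x in lborel. cmod (g x) \<le> norm (M * (1 / (1 + x\<^sup>2)))" by simp
qed (use assms(1) borel_measurable_continuous_onI in auto)

lemma integral_symmetric_tendsto:
  fixes g :: "real \<Rightarrow> complex"
  assumes "integrable lborel g"
  shows "(\<lambda>n. integral {- real n..real n} g) \<longlonglongrightarrow> (LINT x|lborel. g x)"
proof -
  have "(\<lambda>n. LINT x|lborel. indicator {- real n..real n} x *\<^sub>R g x) \<longlonglongrightarrow> (LINT x|lborel. g x)"
  proof (rule integral_dominated_convergence[where w="\<lambda>x. cmod (g x)"])
    show "AE x in lborel. (\<lambda>n. indicator {- real n..real n} x *\<^sub>R g x) \<longlonglongrightarrow> g x"
    proof (rule AE_I2)
      fix x :: real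
      obtain N where "real N \<ge> \<bar>x\<bar>" using real_arch_simple by blast
      then have "\<forall>\<^sub>F n in sequentially. indicator {- real n..real n} x *\<^sub>R g x = g x"
        by (intro eventually_sequentiallyI[of N]) (auto simp: indicator_def)
      then show "(\<lambda>n. indicator {- real n..real n} x *\<^sub>R g x) \<longlonglongrightarrow> g x"
        by (rule tendsto_eventually)
    qed
  qed (use assms in \<open>auto simp: indicator_def\<close>)
  moreover have "(LINT x|lborel. indicator {- real n..real n} x *\<^sub>R g x) = integral {- real n..real n} g" for n
  proof -
    have "set_integrable lborel {- real n..real n} g"
      using assms unfolding set_integrable_def by (intro integrable_mult_indicator) auto
    then show ?thesis
      using set_borel_integral_eq_integral(2) by (simp add: set_lebesgue_integral_def)
  qed
  ultimately show ?thesis by simp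
qed

text \<open>Translation by \<open>i c\<close> reduces a horizontal segment to a segment of the real
  axis.\<close>

lemma has_contour_integral_horizontal_iff:
  assumes "a < b"
  shows "(f has_contour_integral I) (linepath (of_real a + \<i> * of_real c) (of_real b + \<i> * of_real c)) \<longleftrightarrow>
    ((\<lambda>x. f (of_real x + \<i> * of_real c)) has_integral I) {a..b}"
proof -
  have "linepath (of_real a + \<i> * of_real c) (of_real b + \<i> * of_real c) x =
      linepath (complex_of_real a) (of_real b) x + \<i> * of_real c" for x
    by (simp add: linepath_def algebra_simps scaleR_conv_of_real)
  then have "(f has_contour_integral I) (linepath (of_real a + \<i> * of_real c) (of_real b + \<i> * of_real c)) \<longleftrightarrow>
      ((\<lambda>w. f (w + \<i> * of_real c)) has_contour_integral I) (linepath (of_real a) (of_real b))"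
    by (simp add: has_contour_integral_linepath)
  also have "\<dots> \<longleftrightarrow> ((\<lambda>x. f (of_real x + \<i> * of_real c)) has_integral I) {a..b}"
    by (subst has_contour_integral_linepath_Reals_iff) (use assms in auto)
  finally show ?thesis .
qed

text \<open>Cauchy's formula on rectangles whose vertical sides move to infinity. The unit margins
  around \<open>z\<close> ensure that the bound, assumed only at distance at least 1 from the pole,
  applies on both lines. Decay is required of the quotient \<open>q\<close>, not of
  \<open>h\<close>, so a numerator may contain a factor that cancels the denominator.\<close>

lemma Cauchy_integral_formula_strip:
  fixes h :: "complex \<Rightarrow> complex"
  defines "q \<equiv> \<lambda>z w. h w / (w - z)"
  assumes hol: "h holomorphic_on UNIV" and z: "c + 1 \<le> Im z" "Im z + 1 \<le> d"
    and bd: "\<And>w. c \<le> Im w \<Longrightarrow> Im w \<le> d \<Longrightarrow> 1 \<le> cmod (w - z) \<Longrightarrow> cmod (q z w) \<le> M / (1 + (Re w)\<^sup>2)"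
  shows "(LINT x|lborel. q z (of_real x + \<i> * of_real c)) - (LINT x|lborel. q z (of_real x + \<i> * of_real d))
     = 2 * pi * \<i> * h z"
proof -
  have conth: "continuous_on S (\<lambda>x. h (g x))" if "continuous_on S g" for S and g :: "'b::topological_space \<Rightarrow> complex"
    using continuous_on_compose2[OF holomorphic_on_imp_continuous_on[OF hol] that] by auto
  have contq: "continuous_on (-{z}) (q z)"
    unfolding q_def by (intro continuous_intros conth) auto
  have im: "1 \<le> cmod (w - z)" if "1 \<le> \<bar>Im w - Im z\<bar>" for w
    using abs_Im_le_cmod[of "w - z"] that by simp
  have re: "1 \<le> cmod (w - z)" if "1 \<le> \<bar>Re w - Re z\<bar>" for w
    using abs_Re_le_cmod[of "w - z"] that by simp
  have line: "integrable lborel (\<lambda>x. q z (of_real x + \<i> * of_real e))" if e: "e = c \<or> e = d" for e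
  proof (rule integrable_quadratic_decay)
    have ne: "of_real x + \<i> * of_real e \<noteq> z" for x
      using e z by (auto simp: complex_eq_iff)
    then show "continuous_on UNIV (\<lambda>x. q z (of_real x + \<i> * of_real e))"
      by (intro continuous_on_compose2[OF contq] continuous_intros) auto
    show "cmod (q z (of_real x + \<i> * of_real e)) \<le> M / (1 + x\<^sup>2)" for x
      using bd[of "of_real x + \<i> * of_real e"] im[of "of_real x + \<i> * of_real e"] e z by auto
  qed
  have M: "M \<ge> 0"
  proof -
    have "0 \<le> cmod (q z (of_real 0 + \<i> * of_real c))" by simp
    also have "\<dots> \<le> M / (1 + (Re (of_real 0 + \<i> * of_real c))\<^sup>2)"
      using z by (intro bd im) auto
    finally show ?thesis by simp
  qed
  \<comment> \<open>With R >= |Re z| + 1 the point \<open>z\<close> is inside the rectangle and the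
    vertical sides have distance at least 1 from it. The error bound is that of the two vertical
    sides together.\<close>
  have rect: "cmod (integral {-R..R} (\<lambda>x. q z (of_real x + \<i> * of_real c)) -
      integral {-R..R} (\<lambda>x. q z (of_real x + \<i> * of_real d)) - 2 * pi * \<i> * h z) \<le> 2 * M * (d - c) / (1 + R\<^sup>2)"
    if R: "R \<ge> \<bar>Re z\<bar> + 1" for R
  proof -
    define p1 p2 p3 p4 where "p1 = of_real (-R) + \<i> * of_real c" and "p2 = of_real R + \<i> * of_real c"
      and "p3 = of_real R + \<i> * of_real d" and "p4 = of_real (-R) + \<i> * of_real d"
    have rp: "rectpath p1 p3 = linepath p1 p2 +++ linepath p2 p3 +++ linepath p3 p4 +++ linepath p4 p1"
      by (simp add: rectpath_def p1_def p2_def p3_def p4_def Let_def complex_eq_iff Complex_eq)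
    have zin: "z \<in> box p1 p3"
      using R z by (auto simp: in_box_complex_iff p1_def p3_def)
    have pi: "z \<notin> path_image (rectpath p1 p3)"
      using zin path_image_rectpath_cbox_minus_box[of p1 p3] by (auto simp: in_box_complex_iff)
    have "(q z has_contour_integral (2 * pi * \<i> * winding_number (rectpath p1 p3) z * h z)) (rectpath p1 p3)"
      unfolding q_def by (rule Cauchy_integral_formula_convex_simple[of UNIV]) (use hol pi in auto)
    then have tot: "(q z has_contour_integral (2 * pi * \<i> * h z)) (rectpath p1 p3)"
      by (simp add: winding_number_rectpath[OF zin])
    have seg: "q z contour_integrable_on linepath a b" if "z \<notin> closed_segment a b" for a b
      using that by (intro contour_integrable_continuous_linepath continuous_on_subset[OF contq]) auto
    have z12: "z \<notin> closed_segment p1 p2" and z23: "z \<notin> closed_segment p2 p3" and z34: "z \<notin> closed_segment p3 p4"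
      and z41: "z \<notin> closed_segment p4 p1"
      using pi unfolding rp by (auto simp: path_image_join)
    \<comment> \<open>\<open>I3\<close> runs along the top from left to right, against the
      orientation of the rectangle, in order to match an integral over the interval from -R to R.
      Hence it enters the sum with a minus sign.\<close>
    define I1 I2 I3 I4 where "I1 = contour_integral (linepath p1 p2) (q z)"
      and "I2 = contour_integral (linepath p2 p3) (q z)" and "I3 = contour_integral (linepath p4 p3) (q z)"
      and "I4 = contour_integral (linepath p4 p1) (q z)"
    have hI: "(q z has_contour_integral I1) (linepath p1 p2)" "(q z has_contour_integral I2) (linepath p2 p3)"
      "(q z has_contour_integral I3) (linepath p4 p3)" "(q z has_contour_integral I4) (linepath p4 p1)"
      unfolding I1_def I2_def I3_def I4_def
      by (intro has_contour_integral_integral seg; use z12 z23 z34 z41 in \<open>simp add: closed_segment_commute\<close>)+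
    have "(q z has_contour_integral (I1 + (I2 + (-I3 + I4)))) (rectpath p1 p3)"
      unfolding rp using has_contour_integral_reverse_linepath[OF hI(3)]
      by (intro has_contour_integral_join hI) auto
    then have sum: "2 * pi * \<i> * h z = I1 + (I2 + (-I3 + I4))"
      using tot has_contour_integral_unique by blast
    \<comment> \<open>The heights of the end points are given as an unordered pair, so that one
      estimate serves both vertical sides, which are traversed in opposite directions.\<close>
    have v: "cmod I \<le> M / (1 + R\<^sup>2) * cmod (b - a)"
      if "(q z has_contour_integral I) (linepath a b)" and ab: "Re a = Re b" "\<bar>Re a\<bar> = R" "{Im a, Im b} = {c, d}" for I a b
    proof (rule has_contour_integral_bound_linepath[OF that(1)])
      show "0 \<le> M / (1 + R\<^sup>2)" using M by simp
      fix w assume w: "w \<in> closed_segment a b"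
      obtain u where u: "w = (1 - u) *\<^sub>R a + u *\<^sub>R b"
        using w by (auto simp: in_segment)
      have "Re w = Re a"
        by (simp add: u ab(1) algebra_simps)
      moreover have "Im w \<in> closed_segment (Im a) (Im b)"
        using w by (auto simp: closed_segment_def)
      then have "Im w \<in> {c..d}"
        using ab(3) z by (auto simp: closed_segment_eq_real_ivl doubleton_eq_iff split: if_splits)
      moreover have "1 \<le> cmod (w - z)"
        using R ab \<open>Re w = Re a\<close> by (intro re) auto
      moreover have "(Re a)\<^sup>2 = R\<^sup>2"
        using ab(2) by (metis power2_abs)
      ultimately show "cmod (q z w) \<le> M / (1 + R\<^sup>2)"
        using bd[of w] by simp
    qed
    have len: "cmod (p3 - p2) = d - c" "cmod (p1 - p4) = d - c"
      using z by (auto simp: p1_def p2_def p3_def p4_def cmod_def)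
    have "cmod I2 \<le> M / (1 + R\<^sup>2) * (d - c)" "cmod I4 \<le> M / (1 + R\<^sup>2) * (d - c)"
      using v[OF hI(2)] v[OF hI(4)] R by (auto simp: len) (auto simp: p1_def p2_def p3_def p4_def)
    moreover have i1: "integral {-R..R} (\<lambda>x. q z (of_real x + \<i> * of_real c)) = I1"
      using hI(1) R unfolding p1_def p2_def by (subst (asm) has_contour_integral_horizontal_iff) auto
    moreover have i3: "integral {-R..R} (\<lambda>x. q z (of_real x + \<i> * of_real d)) = I3"
      using hI(3) R unfolding p3_def p4_def by (subst (asm) has_contour_integral_horizontal_iff) auto
    moreover have "cmod (I1 - I3 - (I1 + (I2 + (-I3 + I4)))) \<le> cmod I2 + cmod I4"
      by (rule order_trans[OF _ norm_triangle_ineq]) (simp add: norm_minus_commute flip: norm_minus_cancel[of "I2 + I4"])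
    moreover have "2 * M * (d - c) / (1 + R\<^sup>2) = M / (1 + R\<^sup>2) * (d - c) + M / (1 + R\<^sup>2) * (d - c)"
      by simp
    ultimately show ?thesis
      unfolding sum i1 i3 by linarith
  qed
  have "(\<lambda>n. integral {-real n..real n} (\<lambda>x. q z (of_real x + \<i> * of_real c)) -
      integral {-real n..real n} (\<lambda>x. q z (of_real x + \<i> * of_real d)) - 2 * pi * \<i> * h z) \<longlonglongrightarrow>
     (LINT x|lborel. q z (of_real x + \<i> * of_real c)) - (LINT x|lborel. q z (of_real x + \<i> * of_real d)) - 2 * pi * \<i> * h z"
    by (intro tendsto_intros integral_symmetric_tendsto line) auto
  moreover have "(\<lambda>n. integral {-real n..real n} (\<lambda>x. q z (of_real x + \<i> * of_real c)) -
      integral {-real n..real n} (\<lambda>x. q z (of_real x + \<i> * of_real d)) - 2 * pi * \<i> * h z) \<longlonglongrightarrow> 0"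
  proof (rule Lim_null_comparison)
    obtain N where "real N \<ge> \<bar>Re z\<bar> + 1" using real_arch_simple by blast
    then show "\<forall>\<^sub>F n in sequentially. cmod (integral {-real n..real n} (\<lambda>x. q z (of_real x + \<i> * of_real c)) -
      integral {-real n..real n} (\<lambda>x. q z (of_real x + \<i> * of_real d)) - 2 * pi * \<i> * h z) \<le> 2 * M * (d - c) / (1 + (real n)\<^sup>2)"
      by (intro eventually_sequentiallyI[of N] rect) simp
    show "(\<lambda>n. 2 * M * (d - c) / (1 + (real n)\<^sup>2)) \<longlonglongrightarrow> 0"
      by real_asymp
  qed
  ultimately have "(LINT x|lborel. q z (of_real x + \<i> * of_real c)) - (LINT x|lborel. q z (of_real x + \<i> * of_real d)) - 2 * pi * \<i> * h z = 0"
    by (rule LIMSEQ_unique)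
  then show ?thesis by simp
qed

section \<open>The inverse Fourier integral on \<open>H\<^sub>a\<close>\<close>

text \<open>Differentiation under an integral over the whole line by a second-order Taylor estimate:
  the remainder is at most |s (y - x)|^2 |u(s)|, and the integrable second moment turns this into
  \<open>K * (y - x)^2\<close>.\<close>

lemma has_vector_derivative_fourier_integral:
  fixes u :: "real \<Rightarrow> complex"
  assumes "integrable lborel u" "integrable lborel (\<lambda>s. of_real s * u s)" "integrable lborel (\<lambda>s. (of_real s)\<^sup>2 * u s)"
  shows "((\<lambda>x. LINT s|lborel. u s * exp (\<i> * of_real s * of_real x)) has_vector_derivative
     (LINT s|lborel. \<i> * of_real s * u s * exp (\<i> * of_real s * of_real x))) (at x)"
proof -
  let ?F = "\<lambda>x. LINT s|lborel. u s * exp (\<i> * of_real s * of_real x)"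
  let ?F' = "LINT s|lborel. \<i> * of_real s * u s * exp (\<i> * of_real s * of_real x)"
  define K where "K = (LINT s|lborel. cmod ((of_real s)\<^sup>2 * u s))"
  have [measurable]: "u \<in> borel_measurable borel"
    using assms(1) by auto
  have i0: "integrable lborel (\<lambda>s. u s * exp (\<i> * of_real s * of_real y))" for y
    by (rule Bochner_Integration.integrable_bound[OF assms(1)]) (auto simp: norm_mult)
  have i1: "integrable lborel (\<lambda>s. \<i> * of_real s * u s * exp (\<i> * of_real s * of_real x))"
    by (rule Bochner_Integration.integrable_bound[OF assms(2)]) (auto simp: norm_mult)
  have key: "cmod (?F y - ?F x - (y - x) *\<^sub>R ?F') \<le> K * (y - x)\<^sup>2" for y
  proof -
    let ?A = "\<lambda>y s. u s * exp (\<i> * of_real s * of_real y)"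
    let ?B = "\<lambda>s. (y - x) *\<^sub>R (\<i> * of_real s * u s * exp (\<i> * of_real s * of_real x))"
    have iB: "integrable lborel ?B"
      by (rule integrable_scaleR_right[OF i1])
    have iA: "integrable lborel (\<lambda>s. ?A y s - ?A x s)"
      by (rule Bochner_Integration.integrable_diff[OF i0 i0])
    have "?F y - ?F x - (y - x) *\<^sub>R ?F' = (LINT s|lborel. ?A y s - ?A x s - ?B s)"
      unfolding Bochner_Integration.integral_diff[OF iA iB] Bochner_Integration.integral_diff[OF i0 i0]
      by simp
    also have "cmod \<dots> \<le> (LINT s|lborel. cmod ((of_real s)\<^sup>2 * u s) * (y - x)\<^sup>2)"
    proof (rule Bochner_Integration.integral_norm_bound_integral)
      show "integrable lborel (\<lambda>s. cmod ((of_real s)\<^sup>2 * u s) * (y - x)\<^sup>2)"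
        using assms(3) by (intro integrable_mult_left integrable_norm)
      fix s :: real
      define w where "w = \<i> * of_real (s * (y - x))"
      have "u s * exp (\<i> * of_real s * of_real y) -
        u s * exp (\<i> * of_real s * of_real x) - (y - x) *\<^sub>R (\<i> * of_real s * u s * exp (\<i> * of_real s * of_real x))
         = u s * exp (\<i> * of_real s * of_real x) * (exp w - (1 + w))"
      proof -
        have "exp (\<i> * of_real s * of_real y) = exp (\<i> * of_real s * of_real x) * exp w"
          by (simp add: w_def algebra_simps flip: exp_add)
        then show ?thesis
          by (simp add: w_def scaleR_conv_of_real algebra_simps)
      qed
      moreover have "cmod (exp w - (1 + w)) \<le> s\<^sup>2 * (y - x)\<^sup>2"
      proof -
        \<comment> \<open>Since \<open>w\<close> is purely imaginary, the factor
          \<open>exp |Re w|\<close> in the Taylor bound is 1.\<close>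
        have "cmod (exp w - (1 + w)) \<le> (cmod w)\<^sup>2"
          using Taylor_exp[of w 1] by (simp add: w_def power2_eq_square)
        also have "(cmod w)\<^sup>2 = s\<^sup>2 * (y - x)\<^sup>2"
          unfolding w_def norm_mult norm_of_real by (simp add: power_mult_distrib abs_mult)
        finally show ?thesis .
      qed
      ultimately show "cmod (u s * exp (\<i> * of_real s * of_real y) -
        u s * exp (\<i> * of_real s * of_real x) - (y - x) *\<^sub>R (\<i> * of_real s * u s * exp (\<i> * of_real s * of_real x)))
          \<le> cmod ((of_real s)\<^sup>2 * u s) * (y - x)\<^sup>2"
        by (simp add: norm_mult norm_power mult_ac mult_left_mono)
    qed (rule Bochner_Integration.integrable_diff[OF iA iB])
    also have "\<dots> = K * (y - x)\<^sup>2"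
      by (simp add: K_def)
    finally show ?thesis .
  qed
  have "((\<lambda>y. (?F y - ?F x - (y - x) *\<^sub>R ?F') /\<^sub>R norm (y - x)) \<longlongrightarrow> 0) (at x)"
  proof (rule Lim_null_comparison)
    show "\<forall>\<^sub>F y in at x. cmod ((?F y - ?F x - (y - x) *\<^sub>R ?F') /\<^sub>R norm (y - x)) \<le> K * \<bar>y - x\<bar>"
    proof (rule eventually_at_filter[THEN iffD2, OF always_eventually], intro allI impI)
      fix y assume "y \<noteq> x"
      have "cmod ((?F y - ?F x - (y - x) *\<^sub>R ?F') /\<^sub>R norm (y - x)) = cmod (?F y - ?F x - (y - x) *\<^sub>R ?F') / \<bar>y - x\<bar>"
        unfolding norm_scaleR by (simp add: divide_inverse)
      also have "\<dots> \<le> K * (y - x)\<^sup>2 / \<bar>y - x\<bar>"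
        by (rule divide_right_mono[OF key]) simp
      also have "(y - x)\<^sup>2 = \<bar>y - x\<bar> * \<bar>y - x\<bar>"
        by (simp only: power2_eq_square abs_mult_self_eq)
      also have "K * (\<bar>y - x\<bar> * \<bar>y - x\<bar>) / \<bar>y - x\<bar> = K * \<bar>y - x\<bar>"
        using \<open>y \<noteq> x\<close> by (subst nonzero_divide_eq_eq) (simp, simp only: mult.assoc)
      finally show "cmod ((?F y - ?F x - (y - x) *\<^sub>R ?F') /\<^sub>R norm (y - x)) \<le> K * \<bar>y - x\<bar>" .
    qed
    have "((\<lambda>y. K * \<bar>y - x\<bar>) \<longlongrightarrow> K * \<bar>x - x\<bar>) (at x)"
      by (intro tendsto_intros)
    then show "((\<lambda>y. K * \<bar>y - x\<bar>) \<longlongrightarrow> 0) (at x)" by simp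
  qed
  then show ?thesis
    unfolding has_vector_derivative_def has_derivative_at_within
    by (intro conjI bounded_linear_scaleR_left)
qed

text \<open>The antiderivative \<open>exp (c x) / c\<close> tends to 0 at infinity. With c = i (w -
  z) this integral produces the Cauchy kernel in the inversion formula.\<close>

lemma integral_exp_half_line:
  assumes "Re c < 0"
  shows "set_integrable lborel {0<..} (\<lambda>x. exp (c * of_real x))"
    "(LINT x:{0<..}|lborel. exp (c * of_real x)) = - 1 / c"
proof -
  have r: "set_integrable lborel {0<..} (\<lambda>x. exp (Re c * x))"
    using integrable_I0i_exp_mscale[of "- Re c"] assms by (simp add: mult.commute)
  show i: "set_integrable lborel {0<..} (\<lambda>x. exp (c * of_real x))"
    unfolding set_integrable_def
    by (rule Bochner_Integration.integrable_bound[OF r[unfolded set_integrable_def]]) (auto simp: norm_mult)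
  have c0: "c \<noteq> 0" using assms by auto
  have "(LBINT x=0..\<infinity>. exp (c * of_real x)) = 0 - 1 / c"
  proof (rule interval_integral_FTC_integrable)
    show "((\<lambda>x. exp (c * of_real x) / c) has_vector_derivative exp (c * of_real x)) (at x)" for x
      using c0 by (auto intro!: has_vector_derivative_real_field derivative_eq_intros)
    show "set_integrable lborel (einterval 0 \<infinity>) (\<lambda>x. exp (c * of_real x))"
      using i by (simp add: zero_ereal_def)
    have "((\<lambda>x. exp (c * complex_of_real x) / c) \<longlongrightarrow> exp (c * of_real 0) / c) (at_right 0)"
      using c0 by (intro tendsto_intros) auto
    then show "(((\<lambda>x. exp (c * complex_of_real x) / c) \<circ> real_of_ereal) \<longlongrightarrow> 1 / c) (at_right 0)"
      unfolding zero_ereal_def ereal_tendsto_simps by simp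
    have "((\<lambda>x. exp (c * complex_of_real x) / c) \<longlongrightarrow> 0) at_top"
    proof (rule Lim_null_comparison)
      show "\<forall>\<^sub>F x in at_top. cmod (exp (c * complex_of_real x) / c) \<le> exp (Re c * x) / cmod c"
        by (auto simp: norm_divide)
      show "((\<lambda>x. exp (Re c * x) / cmod c) \<longlongrightarrow> 0) at_top"
        using assms c0 by real_asymp
    qed
    then show "(((\<lambda>x. exp (c * complex_of_real x) / c) \<circ> real_of_ereal) \<longlongrightarrow> 0) (at_left \<infinity>)"
      by (simp add: ereal_tendsto_simps)
  qed (auto intro!: continuous_intros)
  then show "(LINT x:{0<..}|lborel. exp (c * of_real x)) = - 1 / c"
    by (simp add: interval_lebesgue_integral_0_infty)
qed

section \<open>Decay, symmetry and integrability in \<open>H_space\<close>\<close>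

lemma H_space_decay:
  assumes "h \<in> H_space a"
  obtains C where "C > 0"
    "\<And>z. cmod (h z) \<le> C * exp (a * \<bar>Im z\<bar>) / (1 + (cmod z)\<^sup>2) ^ n"
proof -
  obtain C where C: "C > 0" "\<And>z. (1 + (cmod z)\<^sup>2) ^ n * cmod (h z) * exp (- a * \<bar>Im z\<bar>) < C"
    using assms unfolding H_space_def by blast
  have "cmod (h z) \<le> C * exp (a * \<bar>Im z\<bar>) / (1 + (cmod z)\<^sup>2) ^ n" for z
  proof -
    have pos: "(1 + (cmod z)\<^sup>2) ^ n > 0"
      by (simp add: add_pos_nonneg)
    have "(1 + (cmod z)\<^sup>2) ^ n * cmod (h z) * exp (- a * \<bar>Im z\<bar>) * exp (a * \<bar>Im z\<bar>) \<le> C * exp (a * \<bar>Im z\<bar>)"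
      using C(2)[of z] by (intro mult_right_mono) auto
    then have "cmod (h z) * (1 + (cmod z)\<^sup>2) ^ n \<le> C * exp (a * \<bar>Im z\<bar>)"
      by (simp add: mult.assoc flip: exp_add) (simp add: mult.commute)
    then show ?thesis
      by (simp only: pos_le_divide_eq[OF pos])
  qed
  with C(1) show ?thesis using that by blast
qed

text \<open>The case n = 1 with |z| weakened to |Re z|: this bound is integrable along every
  horizontal line and uniform in bounded horizontal strips.\<close>

lemma H_space_line_decay:
  assumes "h \<in> H_space a"
  obtains C where "C > 0"
    "\<And>z. cmod (h z) \<le> C * exp (a * \<bar>Im z\<bar>) / (1 + (Re z)\<^sup>2)"
proof -
  obtain C where C: "C > 0" "\<And>z. cmod (h z) \<le> C * exp (a * \<bar>Im z\<bar>) / (1 + (cmod z)\<^sup>2) ^ 1"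
    using H_space_decay[OF assms] by blast
  have "cmod (h z) \<le> C * exp (a * \<bar>Im z\<bar>) / (1 + (Re z)\<^sup>2)" for z
  proof -
    have "(Re z)\<^sup>2 \<le> (cmod z)\<^sup>2"
      by (simp add: cmod_power2)
    then have "C * exp (a * \<bar>Im z\<bar>) / (1 + (cmod z)\<^sup>2) ^ 1 \<le> C * exp (a * \<bar>Im z\<bar>) / (1 + (Re z)\<^sup>2)"
      using C(1) by (intro divide_left_mono) (auto intro!: mult_pos_pos add_pos_nonneg)
    with C(2)[of z] show ?thesis by linarith
  qed
  with C(1) show ?thesis using that by blast
qed

lemma H_space_holomorphic: "h \<in> H_space a \<Longrightarrow> h holomorphic_on UNIV"
  by (simp add: H_space_def)

lemma H_space_continuous:
  assumes "h \<in> H_space a" "continuous_on S g"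
  shows "continuous_on S (\<lambda>x. h (g x))"
  using continuous_on_compose2[OF holomorphic_on_imp_continuous_on[OF H_space_holomorphic[OF assms(1)]] assms(2)]
  by auto

text \<open>Reflection exchanges the two half lines of the inverse Fourier integral, so that
  arguments for positive \<open>x\<close> carry over to negative \<open>x\<close>.\<close>

lemma H_space_reflect:
  assumes "h \<in> H_space a"
  shows "(\<lambda>z. h (- z)) \<in> H_space a"
proof -
  have "(h \<circ> uminus) holomorphic_on UNIV"
    by (rule holomorphic_on_compose) (auto intro!: holomorphic_intros holomorphic_on_subset[OF H_space_holomorphic[OF assms]])
  moreover have "\<exists>c>0. \<forall>z. (1 + (cmod z)\<^sup>2) ^ n * cmod (h (- z)) * exp (- a * \<bar>Im z\<bar>) < c" for n
  proof -
    obtain c where c: "c > 0" "\<And>z. (1 + (cmod z)\<^sup>2) ^ n * cmod (h z) * exp (- a * \<bar>Im z\<bar>) < c"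
      using assms unfolding H_space_def by blast
    have "(1 + (cmod z)\<^sup>2) ^ n * cmod (h (- z)) * exp (- a * \<bar>Im z\<bar>) < c" for z
      using c(2)[of "- z"] by simp
    with c(1) show ?thesis by blast
  qed
  ultimately show ?thesis
    by (simp add: H_space_def o_def)
qed

lemma H_space_uminus:
  assumes "h \<in> H_space a"
  shows "(\<lambda>z. - h z) \<in> H_space a"
  using assms by (auto simp: H_space_def intro!: holomorphic_intros)

lemma H_space_line_integrable:
  assumes "h \<in> H_space a"
  shows "integrable lborel (\<lambda>s. h (of_real s + \<i> * of_real y))"
proof -
  obtain C where C: "C > 0" "\<And>z. cmod (h z) \<le> C * exp (a * \<bar>Im z\<bar>) / (1 + (Re z)\<^sup>2)"
    using H_space_line_decay[OF assms] by blast
  show ?thesis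
  proof (rule integrable_quadratic_decay)
    show "cmod (h (of_real s + \<i> * of_real y)) \<le> C * exp (a * \<bar>y\<bar>) / (1 + s\<^sup>2)" for s
      using C(2)[of "of_real s + \<i> * of_real y"] by simp
  qed (intro H_space_continuous[OF assms] continuous_intros)
qed

text \<open>Of the k + 1 factors \<open>1 + s^2\<close> in the decay bound, k absorb
  \<open>s^k\<close> through |s| <= 1 + s^2, and the last one makes the integrand
  integrable.\<close>

lemma H_space_moments_integrable:
  assumes "h \<in> H_space a"
  shows "integrable lborel (\<lambda>s. of_real s ^ k * h (of_real s))"
proof -
  obtain C where C: "C > 0" "\<And>z. cmod (h z) \<le> C * exp (a * \<bar>Im z\<bar>) / (1 + (cmod z)\<^sup>2) ^ (k + 1)"
    using H_space_decay[OF assms] by blast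
  show ?thesis
  proof (rule integrable_quadratic_decay)
    show "cmod (of_real s ^ k * h (of_real s)) \<le> C / (1 + s\<^sup>2)" for s
    proof -
      have "0 \<le> (\<bar>s\<bar> - 1)\<^sup>2"
        by simp
      then have "\<bar>s\<bar> \<le> 1 + s\<^sup>2"
        unfolding power2_diff by simp
      have "\<bar>s\<bar> ^ k \<le> (1 + s\<^sup>2) ^ k"
        using \<open>\<bar>s\<bar> \<le> 1 + s\<^sup>2\<close> by (intro power_mono) auto
      moreover have "(1 + s\<^sup>2) ^ k > 0"
        by (simp add: add_pos_nonneg)
      moreover have "cmod (of_real s ^ k * h (of_real s)) \<le> \<bar>s\<bar> ^ k * (C / (1 + s\<^sup>2) ^ (k + 1))"
      proof -
        have "cmod (h (of_real s)) \<le> C / (1 + s\<^sup>2) ^ (k + 1)"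
          using C(2)[of "of_real s"] by simp
        then show ?thesis
          unfolding norm_mult norm_power norm_of_real by (intro mult_left_mono) auto
      qed
      moreover have "\<bar>s\<bar> ^ k * (C / (1 + s\<^sup>2) ^ (k + 1)) \<le> (1 + s\<^sup>2) ^ k * (C / (1 + s\<^sup>2) ^ (k + 1))"
        using calculation(1) C(1) by (intro mult_right_mono) auto
      moreover have "(1 + s\<^sup>2) ^ k * (C / (1 + s\<^sup>2) ^ (k + 1)) = C / (1 + s\<^sup>2)"
        using calculation(2) by simp
      ultimately show ?thesis by linarith
    qed
  qed (intro H_space_continuous[OF assms] continuous_intros)
qed

section \<open>Smoothness and support of the inverse Fourier integral\<close>

definition fourier_inverse :: "(complex \<Rightarrow> complex) \<Rightarrow> real \<Rightarrow> complex" where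
  "fourier_inverse h x = (LINT s|lborel. h (of_real s) * exp (\<i> * of_real s * of_real x)) / (2 * pi)"

lemma fourier_inverse_reflect: "fourier_inverse (\<lambda>z. h (- z)) x = fourier_inverse h (- x)"
  unfolding fourier_inverse_def by (subst lborel_integral_real_affine[of "-1" _ 0]) auto

text \<open>Differentiation under the integral takes moments of orders 0, 1 and 2 of the integrand,
  that is, of orders n to n + 2 of \<open>h\<close>. Iterating this step gives all
  derivatives.\<close>

lemma has_vector_derivative_fourier_inverse_moment:
  assumes "h \<in> H_space a"
  shows "(fourier_inverse (\<lambda>z. (\<i> * z) ^ n * h z) has_vector_derivative fourier_inverse (\<lambda>z. (\<i> * z) ^ Suc n * h z) x) (at x)"
proof -
  have i: "integrable lborel (\<lambda>s. of_real s ^ m * ((\<i> * of_real s) ^ n * h (of_real s)))" for m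
  proof -
    have "integrable lborel (\<lambda>s. \<i> ^ n * (of_real s ^ (m + n) * h (of_real s)))"
      by (intro integrable_mult_right H_space_moments_integrable[OF assms])
    then show ?thesis
      by (simp add: power_add power_mult_distrib mult_ac)
  qed
  have "((\<lambda>x. (LINT s|lborel. (\<i> * of_real s) ^ n * h (of_real s) * exp (\<i> * of_real s * of_real x)) / (2 * pi)) has_vector_derivative
     (LINT s|lborel. \<i> * of_real s * ((\<i> * of_real s) ^ n * h (of_real s)) * exp (\<i> * of_real s * of_real x)) / (2 * pi)) (at x)"
    by (intro has_vector_derivative_divide has_vector_derivative_fourier_integral)
       (use i[of 0] i[of 1] i[of 2] in simp_all)
  then show ?thesis
    by (simp add: fourier_inverse_def[abs_def] mult_ac)
qed

lemma smooth_fourier_inverse: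
  assumes "h \<in> H_space a"
  shows "smooth (fourier_inverse h)"
proof -
  note deriv = has_vector_derivative_fourier_inverse_moment[OF assms]
  have eq: "nderiv n (fourier_inverse h) = fourier_inverse (\<lambda>z. (\<i> * z) ^ n * h z)" for n
  proof (induction n)
    case (Suc n)
    have "nderiv (Suc n) (fourier_inverse h) = (\<lambda>x. vector_derivative (nderiv n (fourier_inverse h)) (at x))"
      by simp
    then show ?case
      unfolding Suc vector_derivative_at[OF deriv] .
  qed simp
  show ?thesis
    unfolding smooth_def eq by (intro allI differentiableI_vector[OF deriv])
qed

text \<open>The line of integration moves from height 0 to height \<open>y\<close>. The strip
  formula is applied at the point \<open>i\<close>; \<open>y >= 2\<close> leaves the unit margin
  between \<open>i\<close> and the upper line.\<close>

lemma fourier_inverse_shift: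
  assumes h: "h \<in> H_space a" and y: "y \<ge> 2"
  shows "(LINT s|lborel. h (of_real s) * exp (\<i> * of_real s * of_real x)) =
    (LINT s|lborel. h (of_real s + \<i> * of_real y) * exp (\<i> * (of_real s + \<i> * of_real y) * of_real x))"
proof -
  define k where "k w = h w * exp (\<i> * w * of_real x)" for w
  obtain C where C: "C > 0" "\<And>z. cmod (h z) \<le> C * exp (a * \<bar>Im z\<bar>) / (1 + (Re z)\<^sup>2)"
    using H_space_line_decay[OF h] by blast
  \<comment> \<open>In the strip from height 0 to \<open>y\<close>, the factor
    \<open>exp (|a| * y)\<close> bounds the growth of \<open>h\<close> and
    \<open>exp (|x| * y)\<close> bounds |exp (i w x)| = exp (- Im w * x).\<close>
  define M where "M = C * exp (\<bar>a\<bar> * y) * exp (\<bar>x\<bar> * y)"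
  have bd: "cmod (k w) \<le> M / (1 + (Re w)\<^sup>2)" if "0 \<le> Im w" "Im w \<le> y" for w
  proof -
    have "a * \<bar>Im w\<bar> \<le> \<bar>a\<bar> * y" "- (Im w * x) \<le> \<bar>x\<bar> * y"
    proof -
      show "a * \<bar>Im w\<bar> \<le> \<bar>a\<bar> * y"
        using that by (intro mult_mono) auto
      have "- (Im w * x) \<le> \<bar>Im w * x\<bar>" by simp
      also have "\<dots> = \<bar>x\<bar> * \<bar>Im w\<bar>"
        by (simp add: abs_mult)
      also have "\<dots> \<le> \<bar>x\<bar> * y"
        using that by (intro mult_left_mono) auto
      finally show "- (Im w * x) \<le> \<bar>x\<bar> * y" .
    qed
    then have e: "exp (a * \<bar>Im w\<bar>) \<le> exp (\<bar>a\<bar> * y)" "exp (- (Im w * x)) \<le> exp (\<bar>x\<bar> * y)"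
      by simp_all
    have "cmod (k w) = cmod (h w) * exp (- (Im w * x))"
      by (simp add: k_def norm_mult)
    also have "\<dots> \<le> (C * exp (a * \<bar>Im w\<bar>) / (1 + (Re w)\<^sup>2)) * exp (\<bar>x\<bar> * y)"
      using C e by (intro mult_mono) auto
    also have "\<dots> \<le> (C * exp (\<bar>a\<bar> * y) / (1 + (Re w)\<^sup>2)) * exp (\<bar>x\<bar> * y)"
      using C e by (intro mult_right_mono divide_right_mono mult_left_mono) auto
    finally show ?thesis
      by (simp add: M_def mult_ac)
  qed
  \<comment> \<open>The factor \<open>w - \<i>\<close> vanishes at \<open>\<i>\<close>, so Cauchy's formula for the strip yields Cauchy's theorem for \<open>k\<close>.\<close>
  have hol: "(\<lambda>w. (w - \<i>) * k w) holomorphic_on UNIV"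
    unfolding k_def using H_space_holomorphic[OF h] by (intro holomorphic_intros)
  have "(LINT s|lborel. (of_real s + \<i> * of_real 0 - \<i>) * k (of_real s + \<i> * of_real 0) / (of_real s + \<i> * of_real 0 - \<i>))
      - (LINT s|lborel. (of_real s + \<i> * of_real y - \<i>) * k (of_real s + \<i> * of_real y) / (of_real s + \<i> * of_real y - \<i>))
      = 2 * pi * \<i> * ((\<i> - \<i>) * k \<i>)"
  proof (rule Cauchy_integral_formula_strip[OF hol])
    show "cmod ((w - \<i>) * k w / (w - \<i>)) \<le> M / (1 + (Re w)\<^sup>2)"
      if "0 \<le> Im w" "Im w \<le> y" "1 \<le> cmod (w - \<i>)" for w
      using bd[OF that(1,2)] that(3) by (cases "w = \<i>") auto
  qed (use y in auto)
  moreover have "of_real s + \<i> * of_real e - \<i> \<noteq> 0" if "e \<noteq> 1" for s e :: real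
    using that by (simp add: complex_eq_iff)
  then have "(of_real s + \<i> * of_real e - \<i>) * k (of_real s + \<i> * of_real e) / (of_real s + \<i> * of_real e - \<i>)
       = k (of_real s + \<i> * of_real e)" if "e \<noteq> 1" for s e :: real
    using that by simp
  then have "(LINT s|lborel. (of_real s + \<i> * of_real e - \<i>) * k (of_real s + \<i> * of_real e) / (of_real s + \<i> * of_real e - \<i>))
       = (LINT s|lborel. k (of_real s + \<i> * of_real e))" if "e \<noteq> 1" for e :: real
    using that by presburger
  from this[of 0] this[of y] 
  have "(LINT s|lborel. (of_real s + \<i> * of_real 0 - \<i>) * k (of_real s + \<i> * of_real 0) / (of_real s + \<i> * of_real 0 - \<i>))
       = (LINT s|lborel. k (of_real s))"
    "(LINT s|lborel. (of_real s + \<i> * of_real y - \<i>) * k (of_real s + \<i> * of_real y) / (of_real s + \<i> * of_real y - \<i>))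
       = (LINT s|lborel. k (of_real s + \<i> * of_real y))"
    using y by simp_all
  ultimately have "(LINT s|lborel. k (of_real s)) = (LINT s|lborel. k (of_real s + \<i> * of_real y))"
    by (simp only: diff_self mult_zero_left mult_zero_right right_minus_eq)
  then show ?thesis
    by (simp only: k_def)
qed

text \<open>At height \<open>y\<close> the growth \<open>exp (a y)\<close> of \<open>h\<close> meets
  the decay \<open>exp (- x y)\<close> of the exponential. The integral does not depend on
  \<open>y\<close>, while its bound tends to 0 as \<open>y\<close> grows.\<close>

lemma fourier_inverse_eq_0_right:
  assumes h: "h \<in> H_space a" and x: "x > a"
  shows "fourier_inverse h x = 0"
proof -
  obtain C where C: "C > 0" "\<And>z. cmod (h z) \<le> C * exp (a * \<bar>Im z\<bar>) / (1 + (Re z)\<^sup>2)"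
    using H_space_line_decay[OF h] by blast
  let ?I = "LINT s|lborel. h (of_real s) * exp (\<i> * of_real s * of_real x)"
  define K where "K = C * (LINT s::real|lborel. 1 / (1 + s\<^sup>2))"
  have le: "cmod ?I \<le> K * exp ((a - x) * y)" if y: "y \<ge> 2" for y
  proof -
    let ?g = "\<lambda>s. h (of_real s + \<i> * of_real y) * exp (\<i> * (of_real s + \<i> * of_real y) * of_real x)"
    have g: "cmod (?g s) \<le> C * exp ((a - x) * y) * (1 / (1 + s\<^sup>2))" for s
    proof -
      have "cmod (?g s) = cmod (h (of_real s + \<i> * of_real y)) * exp (- (y * x))"
        by (simp add: norm_mult algebra_simps)
      also have "\<dots> \<le> (C * exp (a * y) / (1 + s\<^sup>2)) * exp (- (y * x))"
        using C(2)[of "of_real s + \<i> * of_real y"] y by (intro mult_right_mono) auto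
      also have "\<dots> = C * exp ((a - x) * y) * (1 / (1 + s\<^sup>2))"
        by (simp add: algebra_simps exp_diff exp_minus divide_inverse)
      finally show ?thesis .
    qed
    have "cmod ?I = cmod (LINT s|lborel. ?g s)"
      by (simp only: fourier_inverse_shift[OF h y])
    also have "\<dots> \<le> (LINT s::real|lborel. C * exp ((a - x) * y) * (1 / (1 + s\<^sup>2)))"
    proof (rule Bochner_Integration.integral_norm_bound_integral[OF _ _ g])
      show "integrable lborel ?g"
        by (rule integrable_quadratic_decay[where M="C * exp ((a - x) * y)"])
           (use g in \<open>auto intro!: H_space_continuous[OF h] continuous_intros\<close>)
      show "integrable lborel (\<lambda>s::real. C * exp ((a - x) * y) * (1 / (1 + s\<^sup>2)))"
        by (intro integrable_mult_right integrable_inverse_one_plus_square)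
    qed
    finally show ?thesis
      unfolding integral_mult_right_zero by (simp only: K_def mult_ac)
  qed
  have "((\<lambda>y. K * exp ((a - x) * y)) \<longlongrightarrow> 0) at_top"
    using x by real_asymp
  then have "cmod ?I \<le> 0"
    by (rule tendsto_lowerbound) (use le in \<open>auto intro: eventually_at_top_linorderI[of 2]\<close>)
  then show ?thesis
    by (simp add: fourier_inverse_def)
qed

lemma fourier_inverse_eq_0:
  assumes "h \<in> H_space a"
  shows "\<forall>x. \<bar>x\<bar> > a \<longrightarrow> fourier_inverse h x = 0"
proof (intro allI impI)
  fix x :: real assume "\<bar>x\<bar> > a"
  then consider "x > a" | "- x > a" by linarith
  then show "fourier_inverse h x = 0"
  proof cases
    case 2
    then show ?thesis
      using fourier_inverse_eq_0_right[OF H_space_reflect[OF assms], of "- x"] by (simp add: fourier_inverse_reflect)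
  qed (rule fourier_inverse_eq_0_right[OF assms])
qed

section \<open>The inversion formula\<close>

text \<open>Over the line at height y > Im z, the factor \<open>exp (i (w - z) x)\<close> decays
  exponentially in x > 0. This permits Fubini, and the integral over \<open>x\<close> then yields
  \<open>i / (w - z)\<close>.\<close>

lemma fourier_inverse_half_line:
  assumes h: "h \<in> H_space a" and y: "y \<ge> 2" "y > Im z"
  shows "(LINT x:{0<..}|lborel. fourier_inverse h x * exp (- \<i> * z * of_real x)) =
    \<i> / (2 * pi) * (LINT s|lborel. h (of_real s + \<i> * of_real y) / (of_real s + \<i> * of_real y - z))"
proof -
  define w where "w s = of_real s + \<i> * of_real y" for s :: real
  define K where "K x s = indicator {0<..} x *\<^sub>R (h (w s) * exp (\<i> * (w s - z) * of_real x))" for x s :: real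
  have ch: "continuous_on UNIV (\<lambda>s. h (w s))"
    unfolding w_def by (intro H_space_continuous[OF h] continuous_intros)
  have [measurable]: "(\<lambda>s. h (w s)) \<in> borel_measurable borel" "w \<in> borel_measurable borel"
    using ch by (auto intro!: borel_measurable_continuous_onI continuous_intros simp: w_def)
  have ih: "integrable lborel (\<lambda>s. h (w s))"
    unfolding w_def by (rule H_space_line_integrable[OF h])
  \<comment> \<open>The modulus splits into a function of \<open>x\<close> times a function of
    \<open>s\<close>, each integrable, which gives absolute integrability on the product.\<close>
  have nK: "cmod (K x s) = (indicator {0<..} x * exp (- (x * (y - Im z)))) * cmod (h (w s))" for x s
    by (auto simp: K_def w_def norm_mult indicator_def algebra_simps)
  have "integrable (lborel \<Otimes>\<^sub>M lborel) (case_prod K)"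
  proof (rule lborel_pair.Fubini_integrable)
    show "case_prod K \<in> borel_measurable (lborel \<Otimes>\<^sub>M lborel)"
      unfolding K_def by measurable
    have "integrable lborel (\<lambda>x. (indicator {0<..} x * exp (- (x * (y - Im z)))) * (LINT s|lborel. cmod (h (w s))))"
      using integrable_I0i_exp_mscale[of "y - Im z"] y by (intro integrable_mult_left) (simp add: set_integrable_def)
    then show "integrable lborel (\<lambda>x. LINT s|lborel. norm (case_prod K (x, s)))"
      by (simp add: nK)
    show "AE x in lborel. integrable lborel (\<lambda>s. case_prod K (x, s))"
    proof (rule AE_I2, rule Bochner_Integration.integrable_bound)
      show "integrable lborel (\<lambda>s. (indicator {0<..} x * exp (- (x * (y - Im z)))) * h (w s))" for x :: real
        using ih by (intro integrable_mult_right)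
      show "AE s in lborel. norm (case_prod K (x, s)) \<le> norm ((indicator {0<..} x * exp (- (x * (y - Im z)))) * h (w s))" for x
        by (auto simp: nK norm_mult indicator_def)
      show "(\<lambda>s. case_prod K (x, s)) \<in> borel_measurable lborel" for x
        unfolding K_def by simp
    qed
  qed
  then have fub: "(LINT s|lborel. LINT x|lborel. K x s) = (LINT x|lborel. LINT s|lborel. K x s)"
    by (rule lborel_pair.Fubini_integral)
  have inner_x: "(LINT x|lborel. K x s) = \<i> * (h (w s) / (w s - z))" for s
  proof -
    have "Im (w s) = y" by (simp add: w_def)
    then have re: "Re (\<i> * (w s - z)) < 0" using y by simp
    have ne: "w s - z \<noteq> 0" using \<open>Im (w s) = y\<close> y by auto
    have "(LINT x|lborel. K x s) = (LINT x|lborel. h (w s) * (indicator {0<..} x *\<^sub>R exp (\<i> * (w s - z) * of_real x)))"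
      by (simp add: K_def)
    also have "\<dots> = h (w s) * (LINT x:{0<..}|lborel. exp (\<i> * (w s - z) * of_real x))"
      unfolding set_lebesgue_integral_def by (rule integral_mult_right_zero)
    also have "\<dots> = h (w s) * (- 1 / (\<i> * (w s - z)))"
      by (simp only: integral_exp_half_line(2)[OF re])
    also have "\<dots> = \<i> * (h (w s) / (w s - z))"
      using ne by (simp add: field_simps)
    finally show ?thesis .
  qed
  \<comment> \<open>For fixed \<open>x\<close>, the shift lemma moves the line back to the real axis
    and recovers \<open>fourier_inverse h x\<close>.\<close>
  have inner_s: "(LINT s|lborel. K x s) = 2 * pi * (indicator {0<..} x *\<^sub>R (fourier_inverse h x * exp (- \<i> * z * of_real x)))" for x
  proof -
    have "K x s = (indicator {0<..} x *\<^sub>R exp (- \<i> * z * of_real x)) * (h (w s) * exp (\<i> * w s * of_real x))" for s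
      by (simp add: K_def algebra_simps flip: exp_add)
    then have "(LINT s|lborel. K x s) = (indicator {0<..} x *\<^sub>R exp (- \<i> * z * of_real x)) * (LINT s|lborel. h (w s) * exp (\<i> * w s * of_real x))"
      by simp
    also have "(LINT s|lborel. h (w s) * exp (\<i> * w s * of_real x)) = 2 * pi * fourier_inverse h x"
      unfolding w_def fourier_inverse_shift[OF h y(1), symmetric] by (simp add: fourier_inverse_def)
    finally show ?thesis by (simp add: mult_ac)
  qed
  have "\<i> * (LINT s|lborel. h (w s) / (w s - z)) = (LINT s|lborel. LINT x|lborel. K x s)"
    unfolding inner_x by (rule integral_mult_right_zero[symmetric])
  also have "\<dots> = 2 * pi * (LINT x:{0<..}|lborel. fourier_inverse h x * exp (- \<i> * z * of_real x))"
    unfolding fub inner_s set_lebesgue_integral_def by (rule integral_mult_right_zero)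
  finally show ?thesis
    unfolding w_def by (simp add: field_simps)
qed

lemma integral_split_half_lines:
  fixes g :: "real \<Rightarrow> complex"
  assumes "integrable lborel g"
  shows "(LINT x|lborel. g x) = (LINT x:{0<..}|lborel. g x) + (LINT x:{0<..}|lborel. g (- x))"
proof -
  have i: "set_integrable lborel {0<..} g" "set_integrable lborel {..<0} g"
    using assms unfolding set_integrable_def by (intro integrable_mult_indicator; simp)+
  have "(LINT x|lborel. g x) = (LINT x|lborel. indicator {0<..} x *\<^sub>R g x + indicator {..<0} x *\<^sub>R g x)"
  proof (rule integral_cong_AE)
    show "AE x in lborel. g x = indicator {0<..} x *\<^sub>R g x + indicator {..<0} x *\<^sub>R g x"
      using AE_lborel_singleton[of 0] by eventually_elim (auto simp: indicator_def)
  qed (use assms i in \<open>auto simp: set_integrable_def\<close>)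
  also have "\<dots> = (LINT x:{0<..}|lborel. g x) + (LINT x:{..<0}|lborel. g x)"
    using i by (simp add: set_integrable_def set_lebesgue_integral_def)
  also have "(LINT x:{..<0}|lborel. g x) = (LINT x:{0<..}|lborel. g (- x))"
    unfolding set_lebesgue_integral_def
    by (subst lborel_integral_real_affine[of "-1" _ 0]) (auto simp: indicator_def intro!: Bochner_Integration.integral_cong)
  finally show ?thesis .
qed

lemma fourier_laplace_fourier_inverse:
  assumes h: "h \<in> H_space a"
  shows "fourier_laplace (fourier_inverse h) z = h z"
proof -
  \<comment> \<open>This height satisfies the half-line lemma at both \<open>z\<close> and
    \<open>-z\<close> and leaves a margin of at least 1 between \<open>z\<close> and the lines at
    heights \<open>y\<close> and \<open>-y\<close>.\<close>
  define y where "y = \<bar>Im z\<bar> + 2"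
  have y: "y \<ge> 2" "y > Im z" "y > Im (- z)"
    by (auto simp: y_def)
  obtain C where C: "C > 0" "\<And>z. cmod (h z) \<le> C * exp (a * \<bar>Im z\<bar>) / (1 + (Re z)\<^sup>2)"
    using H_space_line_decay[OF h] by blast
  have cont: "continuous_on UNIV (fourier_inverse h)"
    using has_vector_derivative_fourier_inverse_moment[OF h, of 0]
    by (auto intro!: continuous_at_imp_continuous_on has_vector_derivative_continuous)
  have "integrable lborel (\<lambda>x. fourier_inverse h x * exp (- \<i> * z * of_real x))"
    by (rule compact_support_mult_exp(1)[OF cont fourier_inverse_eq_0[OF h]])
  then have "fourier_laplace (fourier_inverse h) z =
      (LINT x:{0<..}|lborel. fourier_inverse h x * exp (- \<i> * z * of_real x)) +
      (LINT x:{0<..}|lborel. fourier_inverse h (- x) * exp (- \<i> * z * of_real (- x)))"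
    unfolding fourier_laplace_def by (rule integral_split_half_lines)
  also have "(LINT x:{0<..}|lborel. fourier_inverse h (- x) * exp (- \<i> * z * of_real (- x))) =
      (LINT x:{0<..}|lborel. fourier_inverse (\<lambda>z. h (- z)) x * exp (- \<i> * (- z) * of_real x))"
    by (simp add: fourier_inverse_reflect)
  also have "\<dots> = \<i> / (2 * pi) * (LINT s|lborel. h (- (of_real s + \<i> * of_real y)) / (of_real s + \<i> * of_real y - (- z)))"
    by (rule fourier_inverse_half_line[OF H_space_reflect[OF h] y(1,3)])
  \<comment> \<open>Substituting -s for s passes from the line at height \<open>y\<close> to the one
    at height \<open>-y\<close>; the denominator changes sign, whence the minus.\<close>
  also have "(LINT s|lborel. h (- (of_real s + \<i> * of_real y)) / (of_real s + \<i> * of_real y - (- z))) =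
      (LINT s|lborel. - (h (of_real s + \<i> * of_real (- y)) / (of_real s + \<i> * of_real (- y) - z)))"
  proof (subst lborel_integral_real_affine[of "-1" _ 0])
    have "h (- (of_real (0 + - 1 * s) + \<i> * of_real y)) / (of_real (0 + - 1 * s) + \<i> * of_real y - - z) =
        - (h (of_real s + \<i> * of_real (- y)) / (of_real s + \<i> * of_real (- y) - z))" for s
      using minus_divide_right[of "h (of_real s + \<i> * of_real (- y))" "of_real s + \<i> * of_real (- y) - z"]
      by (simp add: algebra_simps)
    then show "\<bar>-1\<bar> *\<^sub>R (LINT s|lborel. h (- (of_real (0 + - 1 * s) + \<i> * of_real y)) / (of_real (0 + - 1 * s) + \<i> * of_real y - - z)) =
        (LINT s|lborel. - (h (of_real s + \<i> * of_real (- y)) / (of_real s + \<i> * of_real (- y) - z)))"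
      by (simp only: abs_minus abs_one scaleR_one)
  qed simp
  also have "\<dots> = - (LINT s|lborel. h (of_real s + \<i> * of_real (- y)) / (of_real s + \<i> * of_real (- y) - z))"
    by (rule integral_minus)
  also have "(LINT x:{0<..}|lborel. fourier_inverse h x * exp (- \<i> * z * of_real x)) =
    \<i> / (2 * pi) * (LINT s|lborel. h (of_real s + \<i> * of_real y) / (of_real s + \<i> * of_real y - z))"
    by (rule fourier_inverse_half_line[OF h y(1,2)])
  finally have "fourier_laplace (fourier_inverse h) z = - \<i> / (2 * pi) *
      ((LINT s|lborel. h (of_real s + \<i> * of_real (- y)) / (of_real s + \<i> * of_real (- y) - z)) -
       (LINT s|lborel. h (of_real s + \<i> * of_real y) / (of_real s + \<i> * of_real y - z)))"
    by (simp add: algebra_simps)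
  also have "(LINT s|lborel. h (of_real s + \<i> * of_real (- y)) / (of_real s + \<i> * of_real (- y) - z)) -
       (LINT s|lborel. h (of_real s + \<i> * of_real y) / (of_real s + \<i> * of_real y - z)) = 2 * pi * \<i> * h z"
  proof (rule Cauchy_integral_formula_strip[OF H_space_holomorphic[OF h]])
    fix w assume w: "- y \<le> Im w" "Im w \<le> y" "1 \<le> cmod (w - z)"
    have "cmod (h w / (w - z)) = cmod (h w) / cmod (w - z)"
      by (rule norm_divide)
    also have "\<dots> \<le> cmod (h w)"
      using w(3) mult_left_mono[OF w(3), of "cmod (h w)"] by (auto simp: divide_le_eq)
    also have "\<dots> \<le> C * exp (a * \<bar>Im w\<bar>) / (1 + (Re w)\<^sup>2)"
      by (rule C)
    also have "\<dots> \<le> C * exp (\<bar>a\<bar> * y) / (1 + (Re w)\<^sup>2)"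
    proof -
      have "a * \<bar>Im w\<bar> \<le> \<bar>a\<bar> * y"
        using w by (intro mult_mono) auto
      then show ?thesis
        using C(1) by (intro divide_right_mono mult_left_mono) auto
    qed
    finally show "cmod (h w / (w - z)) \<le> C * exp (\<bar>a\<bar> * y) / (1 + (Re w)\<^sup>2)" .
  qed (auto simp: y_def)
  finally show ?thesis
    by simp
qed

section \<open>The range of the transform of index one half\<close>

theorem theorem4p2:
  shows "bessel_struve_transform (1/2) ` test_functions = Lambda_half"
proof (intro equalityI subsetI)
  fix g assume "g \<in> bessel_struve_transform (1/2) ` test_functions"
  then obtain f where f: "f \<in> test_functions" and g: "g = bessel_struve_transform (1/2) f"
    by blast
  obtain a where a: "a > 0" and supp: "\<forall>x. \<bar>x\<bar> > a \<longrightarrow> f x = 0"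
    using test_functions_support[OF f] by blast
  have sm: "smooth f" and cont: "continuous_on UNIV f"
    using f smooth_nderiv(2)[of f 0] by (auto simp: test_functions_def)
  let ?h = "\<lambda>z. - fourier_laplace f z"
  have "?h \<in> H_space a"
    by (intro H_space_uminus fourier_laplace_in_H_space sm supp)
  moreover have "g z = (deriv ?h z - deriv ?h 0) / z" if "z \<noteq> 0" for z
    using bessel_struve_transform_half[OF cont supp, of z] that by (simp add: g)
  moreover have "g holomorphic_on UNIV"
    unfolding g by (rule holomorphic_bessel_struve_transform_half[OF cont supp])
  ultimately have "g \<in> Lambda_half_space a"
    unfolding Lambda_half_space_def by blast
  with a show "g \<in> Lambda_half"
    unfolding Lambda_half_def by auto
next
  fix g assume "g \<in> Lambda_half"
  then obtain a h where a: "a > 0" and holg: "g holomorphic_on UNIV" and h: "h \<in> H_space a"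
    and gh: "\<And>z. z \<noteq> 0 \<Longrightarrow> g z = (deriv h z - deriv h 0) / z"
    unfolding Lambda_half_def Lambda_half_space_def by auto
  \<comment> \<open>The sign matches \<open>bessel_struve_transform_half\<close>, where
    \<open>h\<close> is the negative of the Fourier-Laplace transform.\<close>
  define f where "f = fourier_inverse (\<lambda>z. - h z)"
  note h' = H_space_uminus[OF h]
  have sm: "smooth f" and supp: "\<forall>x. \<bar>x\<bar> > a \<longrightarrow> f x = 0"
    unfolding f_def by (rule smooth_fourier_inverse[OF h'] fourier_inverse_eq_0[OF h'])+
  have cont: "continuous_on UNIV f"
    using smooth_nderiv(2)[OF sm, of 0] by simp
  have "{x. f x \<noteq> 0} \<subseteq> cball 0 a"
    using supp by (force simp: not_less[symmetric])
  then have f: "f \<in> test_functions"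
    using sm bounded_subset[OF bounded_cball] by (auto simp: test_functions_def compact_closure)
  let ?F = "bessel_struve_transform (1/2) f"
  have eq: "?F z = g z" if "z \<noteq> 0" for z
    using bessel_struve_transform_half[OF cont supp, of z] that gh[of z]
    by (simp add: f_def fourier_laplace_fourier_inverse[OF h'])
  \<comment> \<open>The quotient formula leaves \<open>g 0\<close> open; since \<open>?F\<close> and
    \<open>g\<close> are both entire and agree off 0, continuity forces equality at 0.\<close>
  have lim: "?F \<midarrow>0\<rightarrow> ?F 0" "g \<midarrow>0\<rightarrow> g 0"
    using holomorphic_on_imp_continuous_on[OF holomorphic_bessel_struve_transform_half[OF cont supp]]
      holomorphic_on_imp_continuous_on[OF holg]
    by (auto simp: continuous_on_eq_continuous_at isCont_def)
  have "g \<midarrow>0\<rightarrow> ?F 0"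
    by (rule Lim_transform_eventually[OF lim(1)]) (simp add: eventually_at_filter eq)
  then have "?F 0 = g 0"
    using lim(2) LIM_unique by blast
  with eq have "?F = g"
    by (metis ext)
  with f show "g \<in> bessel_struve_transform (1/2) ` test_functions"
    by blast
qed

end
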